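(* Let $E$ be an $n$-dimensional nilpotent evolution algebra over a field $K$, and let $\{e_1,\dots,e_n\}$ be a natural basis of $E$ with respect to which the matrix of structural constants $A=(a_{ij})_{i,j=1}^n$ is strictly upper triangular, i.e. $a_{ij}=0$ for all $i\ge j$. Then $E$ has maximal nilpotent index, namely index of nilpotency $2^{n-1}+1$, if and only if $$a_{12}a_{23}\cdots a_{n-1,n}\neq 0.$$
   Context: An algebra $E$ over a field $K$ is an evolution algebra if it admits a basis $\{e_1,e_2,\dots\}$ (called a natural basis) such that $e_ie_j=0$ for $i\ne j$ and $e_ie_i=\sum_k a_{ik}e_k$; the matrix $A=(a_{ij})$ is the matrix of structural constants of $E$ in this basis. Put $E^1=E$ and $E^k=\sum_{i=1}^{k-1}E^iE^{k-i}$ for $k\ge 2$, where the product of two subspaces is the linear span of all products. $E$ is nilpotent if $E^k=0$ for some $k\in\mathbb N$; the smallest such $k$ is the index of nilpotency (nilpotent index) of $E$. The maximal possible nilpotent index of an $n$-dimensional nilpotent evolution algebra is $2^{n-1}+1$. A nilpotent finite-dimensional evolution algebra has a natural basis in which its matrix of structural constants is strictly upper triangular. *)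

theory Defs
  imports Complex_Main
begin

text \<open>An algebra over a field is a vector space (with carrier the whole type) with a bilinear
  product; neither associativity, nor commutativity, nor a unit is required.\<close>

locale nonassoc_algebra = vector_space scale
  for scale :: "'k::field \<Rightarrow> 'v::ab_group_add \<Rightarrow> 'v" (infixr "*s" 75) +
  fixes mult :: "'v \<Rightarrow> 'v \<Rightarrow> 'v" (infixl "\<bullet>" 70)
  assumes mult_add_left: "(x + y) \<bullet> z = x \<bullet> z + y \<bullet> z"
    and mult_add_right: "x \<bullet> (y + z) = x \<bullet> y + x \<bullet> z"
    and mult_scale_left: "(c *s x) \<bullet> y = c *s (x \<bullet> y)"
    and mult_scale_right: "x \<bullet> (c *s y) = c *s (x \<bullet> y)"
begin

definition natural_basis :: "nat set \<Rightarrow> (nat \<Rightarrow> 'v) \<Rightarrow> bool" where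
  "natural_basis I e \<longleftrightarrow>
     inj_on e I \<and> independent (e ` I) \<and> span (e ` I) = UNIV \<and>
     (\<forall>i\<in>I. \<forall>j\<in>I. i \<noteq> j \<longrightarrow> e i \<bullet> e j = 0)"

text \<open>The expansion of each square in the basis needs no separate requirement here, since every
  element is a (finite) linear combination of basis vectors.\<close>

definition evolution_algebra :: bool where
  "evolution_algebra \<longleftrightarrow> (\<exists>I e. natural_basis I e)"

definition structure_constants :: "nat \<Rightarrow> (nat \<Rightarrow> 'v) \<Rightarrow> (nat \<Rightarrow> nat \<Rightarrow> 'k) \<Rightarrow> bool" where
  "structure_constants n e a \<longleftrightarrow>
     (\<forall>i\<in>{1..n}. e i \<bullet> e i = (\<Sum>k\<in>{1..n}. a i k *s e k))"

definition subspace_prod :: "'v set \<Rightarrow> 'v set \<Rightarrow> 'v set" where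
  "subspace_prod U V = span {x \<bullet> y | x y. x \<in> U \<and> y \<in> V}"

text \<open>The powers \<open>E\<^sup>k\<close> are meaningful for \<open>k \<ge> 1\<close> only; the value at \<open>0\<close> is a dummy. The sum of a
  family of subspaces is the span of their union.\<close>

function alg_power :: "nat \<Rightarrow> 'v set" where
  "alg_power k =
     (if k \<le> 1 then UNIV
      else span (\<Union>i\<in>{1..<k}. subspace_prod (alg_power i) (alg_power (k - i))))"
  by auto
termination
  by (relation "measure id") auto

declare alg_power.simps [simp del]

definition nilpotent :: bool where
  "nilpotent \<longleftrightarrow> (\<exists>k\<ge>1. alg_power k = {0})"

text \<open>Specified only for nilpotent algebras.\<close>

definition nilpotency_index :: nat where
  "nilpotency_index = (LEAST k. 1 \<le> k \<and> alg_power k = {0})"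

end

end

theory Submission
  imports Defs
begin

text \<open>
  Let \<open>V\<^sub>i\<close> be the span of \<open>e\<^sub>i, \<dots>, e\<^sub>n\<close>. Strict triangularity says exactly that multiplication by
  anything pushes \<open>V\<^sub>i\<close> into \<open>V\<^sub>i\<^sub>+\<^sub>1\<close>. If a product of two powers has total degree more than \<open>2\<^sup>m\<close>,
  then one factor has degree more than \<open>2\<^sup>m\<^sup>-\<^sup>1\<close>; by induction this puts every power of degree more
  than \<open>2\<^sup>m\<close> into \<open>V\<^sub>m\<^sub>+\<^sub>2\<close> (lemma \<open>alg_power_subset_tail\<close>). Hence the power of degree
  \<open>2\<^sup>n\<^sup>-\<^sup>1 + 1\<close> always vanishes, and the index is maximal exactly when the power of degree \<open>2\<^sup>n\<^sup>-\<^sup>1\<close> does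
  not (lemma \<open>nilpotency_index_maximal_iff\<close>).

  If all the superdiagonal constants are nonzero, squaring \<open>e\<^sub>1\<close> repeatedly moves its leading
  basis vector by exactly one position each time, because the mixed terms of a square of a sum
  vanish in a natural basis. After \<open>n - 1\<close> squarings a nonzero multiple of \<open>e\<^sub>n\<close> is left, and its
  degree is \<open>2\<^sup>n\<^sup>-\<^sup>1\<close> (lemma \<open>alg_power_leading_term\<close>).

  If instead \<open>a\<^bsub>s,s+1\<^esub> = 0\<close>, then the product \<open>V\<^sub>s V\<^sub>s\<close> lies in \<open>V\<^sub>s\<^sub>+\<^sub>2\<close> already. The only products of
  total degree \<open>2\<^sup>s\<close> without a factor of degree more than \<open>2\<^sup>s\<^sup>-\<^sup>1\<close> are those with both factors of
  degree \<open>2\<^sup>s\<^sup>-\<^sup>1\<close>, and these factors lie in \<open>V\<^sub>s\<close>. So the power of degree \<open>2\<^sup>s\<close> is one step further down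
  than usual, and this gain persists up to degree \<open>2\<^sup>n\<^sup>-\<^sup>1\<close>, whose power lies in
  \<open>V\<^sub>n\<^sub>+\<^sub>1 = 0\<close> (lemma \<open>alg_power_subset_tail_degenerate\<close>).
\<close>

section \<open>Powers of a nonassociative algebra\<close>

context nonassoc_algebra
begin

lemma mult_zero_left [simp]: "0 \<bullet> y = 0"
  using mult_add_left[of 0 0 y] by simp

lemma mult_zero_right [simp]: "x \<bullet> 0 = 0"
  using mult_add_right[of x 0 0] by simp

lemma span_mult_mem:
  assumes W: "subspace W"
    and gen: "\<And>x y. x \<in> S \<Longrightarrow> y \<in> T \<Longrightarrow> x \<bullet> y \<in> W"
    and x: "x \<in> span S" and y: "y \<in> span T"
  shows "x \<bullet> y \<in> W"
proof -
  have right: "z \<bullet> y \<in> W" if "z \<in> S" for z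
    using y
  proof (induction rule: span_induct)
    case base
    show ?case
      by (rule subspaceI) (auto simp: mult_add_right mult_scale_right subspace_0[OF W]
          subspace_add[OF W] subspace_scale[OF W])
  qed (use that gen in auto)
  show ?thesis
    using x
  proof (induction rule: span_induct)
    case base
    show ?case
      by (rule subspaceI) (auto simp: mult_add_left mult_scale_left subspace_0[OF W]
          subspace_add[OF W] subspace_scale[OF W])
  qed (use right in auto)
qed

lemma alg_power_le_one: "k \<le> 1 \<Longrightarrow> alg_power k = UNIV"
  by (subst alg_power.simps) simp

lemma mult_mem_alg_power:
  assumes "1 \<le> i" "1 \<le> j" "x \<in> alg_power i" "y \<in> alg_power j"
  shows "x \<bullet> y \<in> alg_power (i + j)"
proof -
  have "x \<bullet> y \<in> subspace_prod (alg_power i) (alg_power (i + j - i))"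
    unfolding subspace_prod_def using assms by (intro span_base) auto
  moreover have "i \<in> {1..<i + j}"
    using assms by auto
  ultimately have "x \<bullet> y \<in> (\<Union>l\<in>{1..<i + j}. subspace_prod (alg_power l) (alg_power (i + j - l)))"
    by blast
  then show ?thesis
    using assms by (subst alg_power.simps) (auto intro: span_base)
qed

lemma alg_power_subsetI:
  assumes "2 \<le> k" and W: "subspace W"
    and gen: "\<And>i j x y. 1 \<le> i \<Longrightarrow> 1 \<le> j \<Longrightarrow> i + j = k \<Longrightarrow>
                x \<in> alg_power i \<Longrightarrow> y \<in> alg_power j \<Longrightarrow> x \<bullet> y \<in> W"
  shows "alg_power k \<subseteq> W"
proof -
  have "subspace_prod (alg_power i) (alg_power (k - i)) \<subseteq> W" if "i \<in> {1..<k}" for i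
    unfolding subspace_prod_def using that gen[of i "k - i"] by (intro span_minimal W) auto
  then have "span (\<Union>i\<in>{1..<k}. subspace_prod (alg_power i) (alg_power (k - i))) \<subseteq> W"
    by (intro span_minimal W) blast
  then show ?thesis
    using \<open>2 \<le> k\<close> by (subst alg_power.simps) simp
qed

lemma subspace_alg_power: "subspace (alg_power k)"
  by (subst alg_power.simps) auto

text \<open>A product of total degree at least 3 has a factor of degree at least 2, whose degree can be
  lowered by one by induction.\<close>

lemma alg_power_Suc_subset: "alg_power (Suc k) \<subseteq> alg_power k"
proof (induction k rule: less_induct)
  case (less k)
  show ?case
  proof (cases "k \<le> 1")
    case True
    then show ?thesis by (simp add: alg_power_le_one)
  next
    case False
    show ?thesis
    proof (rule alg_power_subsetI)
      fix i j x y
      assume ij: "1 \<le> i" "1 \<le> j" "i + j = Suc k" and x: "x \<in> alg_power i" and y: "y \<in> alg_power j"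
      show "x \<bullet> y \<in> alg_power k"
      proof (cases "i = 1")
        case True
        then have j: "k = i + (j - 1)" "1 \<le> j - 1" "j - 1 < k"
          using ij False by linarith+
        then have "y \<in> alg_power (j - 1)"
          using less.IH[of "j - 1"] y by auto
        then show ?thesis
          using mult_mem_alg_power[OF ij(1) j(2) x] by (simp only: j(1)[symmetric])
      next
        case False
        then have i: "k = (i - 1) + j" "1 \<le> i - 1" "i - 1 < k"
          using ij by linarith+
        then have "x \<in> alg_power (i - 1)"
          using less.IH[of "i - 1"] x by auto
        then show ?thesis
          using mult_mem_alg_power[OF i(2) ij(2) _ y] by (simp only: i(1)[symmetric])
      qed
    qed (use False subspace_alg_power in auto)
  qed
qed

lemma alg_power_antimono: "i \<le> j \<Longrightarrow> alg_power j \<subseteq> alg_power i"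
  using lift_Suc_antimono_le[of alg_power] alg_power_Suc_subset by blast

lemma nilpotency_index_eq_Suc_iff:
  assumes "1 \<le> k" and zero: "alg_power (Suc k) = {0}"
  shows "nilpotency_index = Suc k \<longleftrightarrow> alg_power k \<noteq> {0}"
proof
  assume "nilpotency_index = Suc k"
  then show "alg_power k \<noteq> {0}"
    using not_less_Least[of k "\<lambda>k. 1 \<le> k \<and> alg_power k = {0}"] \<open>1 \<le> k\<close>
    by (auto simp: nilpotency_index_def)
next
  assume nonzero: "alg_power k \<noteq> {0}"
  show "nilpotency_index = Suc k"
    unfolding nilpotency_index_def
  proof (rule Least_equality)
    fix l assume l: "1 \<le> l \<and> alg_power l = {0}"
    show "Suc k \<le> l"
    proof (rule ccontr)
      assume "\<not> Suc k \<le> l"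
      then have "alg_power k \<subseteq> {0}"
        using alg_power_antimono[of l k] l by auto
      then show False
        using nonzero subspace_0[OF subspace_alg_power[of k]] by blast
    qed
  qed (use zero in auto)
qed

end

section \<open>Strictly triangular evolution algebras\<close>

locale triangular_evolution_algebra = nonassoc_algebra scale mult
  for scale :: "'k::field \<Rightarrow> 'v::ab_group_add \<Rightarrow> 'v" (infixr "*s" 75)
    and mult :: "'v \<Rightarrow> 'v \<Rightarrow> 'v" (infixl "\<bullet>" 70) +
  fixes n :: nat and e :: "nat \<Rightarrow> 'v" and a :: "nat \<Rightarrow> nat \<Rightarrow> 'k"
  assumes n_pos: "1 \<le> n"
    and natural_basis: "natural_basis {1..n} e"
    and structure_constants: "structure_constants n e a"
    and strictly_triangular: "\<And>i j. i \<in> {1..n} \<Longrightarrow> j \<in> {1..n} \<Longrightarrow> i \<ge> j \<Longrightarrow> a i j = 0"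
begin

definition tail :: "nat \<Rightarrow> 'v set" where
  "tail i = span (e ` {i..n})"

lemma basis_mult: "i \<in> {1..n} \<Longrightarrow> j \<in> {1..n} \<Longrightarrow> i \<noteq> j \<Longrightarrow> e i \<bullet> e j = 0"
  using natural_basis by (auto simp: natural_basis_def)

lemma basis_nonzero: "i \<in> {1..n} \<Longrightarrow> e i \<noteq> 0"
  using natural_basis dependent_zero[of "e ` {1..n}"] by (force simp: natural_basis_def)

lemma subspace_tail [simp]: "subspace (tail i)"
  by (simp add: tail_def)

lemma basis_mem_tail: "i \<le> j \<Longrightarrow> j \<le> n \<Longrightarrow> e j \<in> tail i"
  unfolding tail_def by (intro span_base) auto

lemma tail_antimono: "i \<le> j \<Longrightarrow> tail j \<subseteq> tail i"
  unfolding tail_def by (intro span_mono image_mono) auto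

lemma tail_one: "tail 1 = UNIV"
  using natural_basis by (simp add: tail_def natural_basis_def)

lemma tail_Suc_n: "tail (Suc n) = {0}"
  by (simp add: tail_def)

lemma basis_square:
  assumes "i \<in> {1..n}"
  shows "e i \<bullet> e i = (\<Sum>k\<in>{i<..n}. a i k *s e k)"
proof -
  have "e i \<bullet> e i = (\<Sum>k\<in>{1..n}. a i k *s e k)"
    using assms structure_constants by (auto simp: structure_constants_def)
  also have "\<dots> = (\<Sum>k\<in>{i<..n}. a i k *s e k)"
    using assms strictly_triangular by (intro sum.mono_neutral_right) auto
  finally show ?thesis .
qed

lemma basis_square_mem_tail:
  assumes "i \<in> {1..n}"
  shows "e i \<bullet> e i \<in> tail (Suc i)"
  unfolding basis_square[OF assms]
  by (intro subspace_sum subspace_scale subspace_tail basis_mem_tail) auto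

lemma basis_square_leading_term:
  assumes "1 \<le> i" "i < n"
  obtains w where "w \<in> tail (i + 2)" "e i \<bullet> e i = a i (Suc i) *s e (Suc i) + w"
proof
  show "(\<Sum>k\<in>{Suc i<..n}. a i k *s e k) \<in> tail (i + 2)"
    by (intro subspace_sum subspace_scale subspace_tail basis_mem_tail) auto
  have "{i<..n} = insert (Suc i) {Suc i<..n}"
    using assms by auto
  then show "e i \<bullet> e i = a i (Suc i) *s e (Suc i) + (\<Sum>k\<in>{Suc i<..n}. a i k *s e k)"
    using assms basis_square[of i] by simp
qed

text \<open>Only the squares of \<open>e\<^sub>i, \<dots>, e\<^sub>n\<close> contribute to a product with a factor in \<open>tail i\<close>.\<close>

lemma tail_mult_mem:
  assumes "1 \<le> i" and x: "x \<in> tail i"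
  shows "x \<bullet> y \<in> tail (Suc i)" "y \<bullet> x \<in> tail (Suc i)"
proof -
  have gen: "e j \<bullet> e k \<in> tail (Suc i)" if "j \<in> {1..n}" "k \<in> {1..n}" "i \<le> j \<or> i \<le> k" for j k
  proof (cases "j = k")
    case True
    then show ?thesis
      using that basis_square_mem_tail[of j] tail_antimono[of "Suc i" "Suc j"] by auto
  next
    case False
    then show ?thesis
      using that basis_mult by (simp add: subspace_0)
  qed
  have y: "y \<in> span (e ` {1..n})"
    using tail_one by (simp add: tail_def)
  show "x \<bullet> y \<in> tail (Suc i)"
    by (rule span_mult_mem[OF subspace_tail _ x[unfolded tail_def] y]) (use gen \<open>1 \<le> i\<close> in auto)
  show "y \<bullet> x \<in> tail (Suc i)"
    by (rule span_mult_mem[OF subspace_tail _ y x[unfolded tail_def]]) (use gen \<open>1 \<le> i\<close> in auto)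
qed

lemma tail_mult_tail_mem_degenerate:
  assumes s: "1 \<le> s" "s < n" and degenerate: "a s (Suc s) = 0"
    and x: "x \<in> tail s" and y: "y \<in> tail s"
  shows "x \<bullet> y \<in> tail (s + 2)"
proof -
  have gen: "e j \<bullet> e k \<in> tail (s + 2)" if "j \<in> {s..n}" "k \<in> {s..n}" for j k
  proof -
    have "j = s \<or> Suc s \<le> j"
      using that by auto
    then consider "j \<noteq> k" | "j = s" "k = s" | "j = k" "Suc s \<le> j"
      by blast
    then show ?thesis
    proof cases
      case 1
      then show ?thesis
        using that s basis_mult by (simp add: subspace_0)
    next
      case 2
      obtain w where "w \<in> tail (s + 2)" "e s \<bullet> e s = a s (Suc s) *s e (Suc s) + w"
        using s by (rule basis_square_leading_term)
      then show ?thesis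
        using 2 degenerate by simp
    next
      case 3
      then show ?thesis
        using that s basis_square_mem_tail[of j] tail_antimono[of "s + 2" "Suc j"] by auto
    qed
  qed
  show ?thesis
    by (rule span_mult_mem[OF subspace_tail _ x[unfolded tail_def] y[unfolded tail_def]])
      (use gen in auto)
qed

section \<open>Powers against tails\<close>

text \<open>One of two positive degrees with sum above \<open>2\<^sup>m\<^sup>+\<^sup>1\<close> exceeds \<open>2\<^sup>m\<close>, and the other factor costs one
  more step along the tails. Doubling the degree therefore gains only one step, whence the
  exponential bound on the index.\<close>

lemma alg_power_subset_tail:
  "2 ^ m < k \<Longrightarrow> alg_power k \<subseteq> tail (m + 2)"
proof (induction m arbitrary: k)
  case 0
  show ?case
  proof (rule alg_power_subsetI)
    show "x \<bullet> y \<in> tail (0 + 2)" for x y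
      using tail_mult_mem(1)[of 1 x y] tail_one by (simp add: numeral_2_eq_2)
  qed (use 0 in auto)
next
  case (Suc m)
  show ?case
  proof (rule alg_power_subsetI)
    fix i j x y
    assume "i + j = k" and x: "x \<in> alg_power i" and y: "y \<in> alg_power j"
    then consider "2 ^ m < i" | "2 ^ m < j"
      using Suc.prems by (cases "2 ^ m < i") auto
    then have "x \<in> tail (m + 2) \<or> y \<in> tail (m + 2)"
      using Suc.IH x y by cases blast+
    then show "x \<bullet> y \<in> tail (Suc m + 2)"
      using tail_mult_mem[of "m + 2"] by auto
  next
    show "2 \<le> k"
      using Suc.prems one_le_power[of "2::nat" "Suc m"] by linarith
  qed simp
qed

text \<open>This is the same halving argument started at degree \<open>2\<^sup>s\<close>. There the split into two equal
  halves escapes \<open>alg_power_subset_tail\<close>, and the vanishing constant takes care of it.\<close>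

lemma alg_power_subset_tail_degenerate:
  assumes s: "1 \<le> s" "s < n" and degenerate: "a s (Suc s) = 0"
  shows "s \<le> m \<Longrightarrow> alg_power (2 ^ m) \<subseteq> tail (m + 2)"
proof (induction m rule: dec_induct)
  case base
  obtain r where r: "s = Suc r"
    using s by (cases s) auto
  have half: "alg_power (2 ^ r) \<subseteq> tail s"
  proof (cases r)
    case 0
    then show ?thesis using r tail_one by simp
  next
    case (Suc q)
    then show ?thesis
      using r alg_power_subset_tail[of q "2 ^ r"] by simp
  qed
  show ?case
  proof (rule alg_power_subsetI)
    fix i j x y
    assume ij: "i + j = 2 ^ s" and x: "x \<in> alg_power i" and y: "y \<in> alg_power j"
    consider "2 ^ r < i" | "2 ^ r < j" | "i = 2 ^ r" "j = 2 ^ r"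
      using ij r by (cases "2 ^ r < i"; cases "2 ^ r < j") auto
    then show "x \<bullet> y \<in> tail (s + 2)"
    proof cases
      case 1
      then show ?thesis
        using alg_power_subset_tail[of r i] x r tail_mult_mem(1)[of "s + 1" x y] by auto
    next
      case 2
      then show ?thesis
        using alg_power_subset_tail[of r j] y r tail_mult_mem(2)[of "s + 1" y x] by auto
    next
      case 3
      then show ?thesis
        using half x y tail_mult_tail_mem_degenerate[OF s degenerate] by auto
    qed
  qed (use r in simp_all)
next
  case (step m)
  show ?case
  proof (rule alg_power_subsetI)
    fix i j x y
    assume "i + j = 2 ^ Suc m" and x: "x \<in> alg_power i" and y: "y \<in> alg_power j"
    then consider "2 ^ m \<le> i" | "2 ^ m \<le> j"
      by (cases "2 ^ m \<le> i") auto
    then have "x \<in> tail (m + 2) \<or> y \<in> tail (m + 2)"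
      using step.IH x y alg_power_antimono by cases blast+
    then show "x \<bullet> y \<in> tail (Suc m + 2)"
      using tail_mult_mem[of "m + 2"] by auto
  qed simp_all
qed

text \<open>The witnesses are the iterated squares of \<open>e\<^sub>1\<close>.\<close>

lemma alg_power_leading_term:
  assumes superdiagonal: "\<forall>i\<in>{1..<n}. a i (Suc i) \<noteq> 0"
  shows "m < n \<Longrightarrow> \<exists>c v. c \<noteq> 0 \<and> v \<in> tail (m + 2) \<and> c *s e (Suc m) + v \<in> alg_power (2 ^ m)"
proof (induction m)
  case 0
  have "(1::'k) \<noteq> 0 \<and> 0 \<in> tail (0 + 2) \<and> 1 *s e (Suc 0) + 0 \<in> alg_power (2 ^ 0)"
    by (simp add: subspace_0 alg_power_le_one)
  then show ?case by blast
next
  case (Suc m)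
  then obtain c v where c: "c \<noteq> 0" and v: "v \<in> tail (m + 2)"
    and power: "c *s e (Suc m) + v \<in> alg_power (2 ^ m)"
    by auto
  obtain w where w: "w \<in> tail (m + 3)"
    and square: "e (Suc m) \<bullet> e (Suc m) = a (Suc m) (m + 2) *s e (m + 2) + w"
    using Suc.prems basis_square_leading_term[of "Suc m"] by (auto simp: eval_nat_numeral)
  have cross: "e (Suc m) \<bullet> v = 0" "v \<bullet> e (Suc m) = 0"
  proof -
    have e: "e (Suc m) \<in> span {e (Suc m)}" and zero: "subspace {0}"
      by (auto intro: span_base)
    have "e (Suc m) \<bullet> v \<in> {0}"
      by (rule span_mult_mem[OF zero _ e v[unfolded tail_def]])
        (use Suc.prems basis_mult in auto)
    moreover have "v \<bullet> e (Suc m) \<in> {0}"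
      by (rule span_mult_mem[OF zero _ v[unfolded tail_def] e])
        (use Suc.prems basis_mult in auto)
    ultimately show "e (Suc m) \<bullet> v = 0" "v \<bullet> e (Suc m) = 0"
      by auto
  qed
  let ?c = "c * c * a (Suc m) (m + 2)" and ?v = "(c * c) *s w + v \<bullet> v"
  have "(c *s e (Suc m) + v) \<bullet> (c *s e (Suc m) + v) = ?c *s e (m + 2) + ?v"
    by (simp add: mult_add_left mult_add_right mult_scale_left mult_scale_right cross square
        scale_right_distrib mult.assoc add.assoc)
  moreover have "(c *s e (Suc m) + v) \<bullet> (c *s e (Suc m) + v) \<in> alg_power (2 ^ Suc m)"
    using mult_mem_alg_power[OF _ _ power power] by (simp add: mult_2)
  moreover have "?c \<noteq> 0"
    using c Suc.prems superdiagonal by auto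
  moreover have "?v \<in> tail (m + 3)"
    using w tail_mult_mem(1)[OF _ v, of v]
    by (auto intro!: subspace_add subspace_scale simp: eval_nat_numeral)
  ultimately show ?case
    by (intro exI[of _ ?c] exI[of _ ?v]) (simp add: eval_nat_numeral)
qed

lemma nilpotency_index_maximal_iff:
  "nilpotency_index = 2 ^ (n - 1) + 1 \<longleftrightarrow> alg_power (2 ^ (n - 1)) \<noteq> {0}"
proof -
  have "alg_power (Suc (2 ^ (n - 1))) \<subseteq> {0}"
    using alg_power_subset_tail[of "n - 1" "Suc (2 ^ (n - 1))"] n_pos tail_Suc_n by simp
  then have "alg_power (Suc (2 ^ (n - 1))) = {0}"
    using subspace_0[OF subspace_alg_power] by blast
  then show ?thesis
    using nilpotency_index_eq_Suc_iff[of "2 ^ (n - 1)"] by simp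
qed

lemma alg_power_nonzero_iff_superdiagonal:
  "alg_power (2 ^ (n - 1)) \<noteq> {0} \<longleftrightarrow> (\<forall>i\<in>{1..<n}. a i (Suc i) \<noteq> 0)"
proof
  assume nonzero: "alg_power (2 ^ (n - 1)) \<noteq> {0}"
  show "\<forall>i\<in>{1..<n}. a i (Suc i) \<noteq> 0"
  proof (intro ballI notI)
    fix s assume s: "s \<in> {1..<n}" and degenerate: "a s (Suc s) = 0"
    have "alg_power (2 ^ (n - 1)) \<subseteq> tail (n - 1 + 2)"
    proof (rule alg_power_subset_tail_degenerate)
      show "1 \<le> s" "s < n" "s \<le> n - 1"
        using s by (auto simp: le_diff_conv2[OF n_pos])
    qed (fact degenerate)
    then have "alg_power (2 ^ (n - 1)) \<subseteq> {0}"
      using n_pos tail_Suc_n by simp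
    then show False
      using nonzero subspace_0[OF subspace_alg_power] by blast
  qed
next
  assume "\<forall>i\<in>{1..<n}. a i (Suc i) \<noteq> 0"
  then obtain c v where "c \<noteq> 0" "v \<in> tail (Suc n)" "c *s e n + v \<in> alg_power (2 ^ (n - 1))"
    using alg_power_leading_term[of "n - 1"] n_pos by auto
  moreover have "e n \<noteq> 0"
    using basis_nonzero n_pos by auto
  ultimately show "alg_power (2 ^ (n - 1)) \<noteq> {0}"
    using tail_Suc_n by auto
qed

end

section \<open>Maximal nilpotency index\<close>

theorem theorem3p6:
  fixes scale :: "'k::field \<Rightarrow> 'v::ab_group_add \<Rightarrow> 'v"
    and mult :: "'v \<Rightarrow> 'v \<Rightarrow> 'v"
    and n :: nat
    and e :: "nat \<Rightarrow> 'v"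
    and a :: "nat \<Rightarrow> nat \<Rightarrow> 'k"
  assumes "nonassoc_algebra scale mult"
    and "nonassoc_algebra.evolution_algebra scale mult"
    and "nonassoc_algebra.nilpotent scale mult"
    and "n \<ge> 1"
    and "vector_space.dim scale UNIV = n"
    and "nonassoc_algebra.natural_basis scale mult {1..n} e"
    and "nonassoc_algebra.structure_constants scale mult n e a"
    and "\<And>i j. i \<in> {1..n} \<Longrightarrow> j \<in> {1..n} \<Longrightarrow> i \<ge> j \<Longrightarrow> a i j = 0"
  shows "nonassoc_algebra.nilpotency_index scale mult = 2 ^ (n - 1) + 1
         \<longleftrightarrow> (\<Prod>i\<in>{1..<n}. a i (i + 1)) \<noteq> 0"
proof -
  interpret nonassoc_algebra scale mult
    by fact
  interpret triangular_evolution_algebra scale mult n e a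
    using assms(4,6,7,8) by unfold_locales
  show ?thesis
    unfolding nilpotency_index_maximal_iff alg_power_nonzero_iff_superdiagonal
    by simp
qed

end
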